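(* Let $\mathcal G$ be a connected groupoid and let $\psi:\mathcal G\to G$ be a nondegenerate cocycle into a discrete group $G$. The following are equivalent: (i) $\mathcal G\times_\psi G$ is connected; (ii) $\psi(\mathcal G_x)=G$ for every $x\in\mathcal G^0$; (iii) $\psi(\mathcal G_x)=G$ for some $x\in\mathcal G^0$; (iv) there is a maximal tree of $\mathcal G$ contained in $\ker\psi$; (v) for every $x\in\mathcal G^0$ there is a maximal tree of $\mathcal G$ rooted at $x$ contained in $\ker\psi$; (vi) $\psi$ factors through a retraction $\eta:\mathcal G\to\mathcal G_x$ for every $x\in\mathcal G^0$; (vii) $\psi$ factors through a retraction $\eta:\mathcal G\to\mathcal G_x$ for some $x\in\mathcal G^0$.
   Context: A groupoid $\mathcal G$ is identified with its set of morphisms, with vertices (objects, identified with identity morphisms) forming $\mathcal G^0\subseteq\mathcal G$, and range and source maps $r,s$; $ab$ is defined iff $s(a)=r(b)$. $y\mathcal G x$ is the set of elements with range $y$ and source $x$, and $\mathcal G_x=x\mathcal G x$ is the isotropy group at $x$. Groupoids are assumed nonempty; $\mathcal G$ is connected if $y\mathcal G x\neq\varnothing$ for all $x,y\in\mathcal G^0$. A cocycle is a functor $\psi:\mathcal G\to G$ into a group; $\ker\psi=\{a\in\mathcal G:\psi(a)=e\}$. It is nondegenerate if $\psi(\mathcal G)$ generates $G$ as a group. The skew product $\mathcal G\times_\psi G$ is the groupoid $\mathcal G\times G$ with vertex set $\mathcal G^0\times G$, $s(a,g)=(s(a),g)$, $r(a,g)=(r(a),\psi(a)g)$, and $(a,g)(b,h)=(ab,h)$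 defined if $s(a)=r(b)$ and $g=\psi(b)h$. A maximal tree in $\mathcal G$ rooted at $x\in\mathcal G^0$ is a family $T=\{t_y\}_{y\in\mathcal G^0}$ with $t_y\in y\mathcal G x$ for each $y$ and $t_x=x$. A maximal tree is a maximal tree rooted at some vertex. A retraction of $\mathcal G$ on a subgroupoid $\mathcal H$ is a groupoid morphism $\mathcal G\to\mathcal H$ that is the identity on $\mathcal H$. "$\psi$ factors through a retraction $\eta:\mathcal G\to\mathcal G_x$" means that there are such a retraction $\eta$ and a group homomorphism $\phi:\mathcal G_x\to G$ with $\psi=\phi\circ\eta$. *)

theory Defs
  imports "HOL-Algebra.Group" "HOL-Algebra.Generated_Groups"
begin

text \<open>A groupoid is given by its set of morphisms; vertices are the identity morphisms.
  The composite \<open>gcomp \<G> a b\<close> is meaningful only when \<open>src \<G> a = rng \<G> b\<close>.\<close>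

record 'a groupoid_data =
  arrows :: "'a set"
  verts :: "'a set"
  src :: "'a \<Rightarrow> 'a"
  rng :: "'a \<Rightarrow> 'a"
  gcomp :: "'a \<Rightarrow> 'a \<Rightarrow> 'a"

locale groupoid =
  fixes \<G> :: "'a groupoid_data"
  assumes nonempty: "arrows \<G> \<noteq> {}"
    and verts_arrows: "verts \<G> \<subseteq> arrows \<G>"
    and src_verts: "a \<in> arrows \<G> \<Longrightarrow> src \<G> a \<in> verts \<G>"
    and rng_verts: "a \<in> arrows \<G> \<Longrightarrow> rng \<G> a \<in> verts \<G>"
    and src_vert: "x \<in> verts \<G> \<Longrightarrow> src \<G> x = x"
    and rng_vert: "x \<in> verts \<G> \<Longrightarrow> rng \<G> x = x"
    and comp_closed:
      "\<lbrakk>a \<in> arrows \<G>; b \<in> arrows \<G>; src \<G> a = rng \<G> b\<rbrakk> \<Longrightarrow> gcomp \<G> a b \<in> arrows \<G>"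
    and src_comp:
      "\<lbrakk>a \<in> arrows \<G>; b \<in> arrows \<G>; src \<G> a = rng \<G> b\<rbrakk> \<Longrightarrow> src \<G> (gcomp \<G> a b) = src \<G> b"
    and rng_comp:
      "\<lbrakk>a \<in> arrows \<G>; b \<in> arrows \<G>; src \<G> a = rng \<G> b\<rbrakk> \<Longrightarrow> rng \<G> (gcomp \<G> a b) = rng \<G> a"
    and comp_assoc:
      "\<lbrakk>a \<in> arrows \<G>; b \<in> arrows \<G>; c \<in> arrows \<G>; src \<G> a = rng \<G> b; src \<G> b = rng \<G> c\<rbrakk>
        \<Longrightarrow> gcomp \<G> (gcomp \<G> a b) c = gcomp \<G> a (gcomp \<G> b c)"
    and comp_src: "a \<in> arrows \<G> \<Longrightarrow> gcomp \<G> a (src \<G> a) = a"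
    and rng_gcomp: "a \<in> arrows \<G> \<Longrightarrow> gcomp \<G> (rng \<G> a) a = a"
    and inverse_ex:
      "a \<in> arrows \<G> \<Longrightarrow> \<exists>b\<in>arrows \<G>. src \<G> b = rng \<G> a \<and> rng \<G> b = src \<G> a \<and>
        gcomp \<G> b a = src \<G> a \<and> gcomp \<G> a b = rng \<G> a"

text \<open>\<open>arrows_between \<G> y x\<close> is \<open>y\<G>x\<close>: the first argument is the range, the second the source.\<close>

definition arrows_between :: "'a groupoid_data \<Rightarrow> 'a \<Rightarrow> 'a \<Rightarrow> 'a set" where
  "arrows_between \<G> y x = {a \<in> arrows \<G>. rng \<G> a = y \<and> src \<G> a = x}"

definition connected_groupoid :: "'a groupoid_data \<Rightarrow> bool" where
  "connected_groupoid \<G> \<longleftrightarrow>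
    groupoid \<G> \<and> (\<forall>x\<in>verts \<G>. \<forall>y\<in>verts \<G>. arrows_between \<G> y x \<noteq> {})"

definition groupoid_hom :: "'a groupoid_data \<Rightarrow> 'b groupoid_data \<Rightarrow> ('a \<Rightarrow> 'b) \<Rightarrow> bool" where
  "groupoid_hom \<G> \<H> f \<longleftrightarrow>
    f \<in> arrows \<G> \<rightarrow> arrows \<H> \<and> f \<in> verts \<G> \<rightarrow> verts \<H> \<and>
    (\<forall>a\<in>arrows \<G>. src \<H> (f a) = f (src \<G> a) \<and> rng \<H> (f a) = f (rng \<G> a)) \<and>
    (\<forall>a\<in>arrows \<G>. \<forall>b\<in>arrows \<G>. src \<G> a = rng \<G> b \<longrightarrow>
      f (gcomp \<G> a b) = gcomp \<H> (f a) (f b))"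

definition subgroupoid :: "'a groupoid_data \<Rightarrow> 'a groupoid_data \<Rightarrow> bool" where
  "subgroupoid \<H> \<G> \<longleftrightarrow>
    groupoid \<H> \<and> arrows \<H> \<subseteq> arrows \<G> \<and> verts \<H> \<subseteq> verts \<G> \<and>
    (\<forall>a\<in>arrows \<H>. src \<H> a = src \<G> a \<and> rng \<H> a = rng \<G> a) \<and>
    (\<forall>a\<in>arrows \<H>. \<forall>b\<in>arrows \<H>. src \<H> a = rng \<H> b \<longrightarrow> gcomp \<H> a b = gcomp \<G> a b)"

definition retraction_on :: "'a groupoid_data \<Rightarrow> 'a groupoid_data \<Rightarrow> ('a \<Rightarrow> 'a) \<Rightarrow> bool" where
  "retraction_on \<G> \<H> \<eta> \<longleftrightarrow>
    subgroupoid \<H> \<G> \<and> groupoid_hom \<G> \<H> \<eta> \<and> (\<forall>a\<in>arrows \<H>. \<eta> a = a)"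

text \<open>The isotropy group \<open>\<G>\<^sub>x = x\<G>x\<close> appears both as a one-vertex subgroupoid of \<open>\<G>\<close> (the target
  of a retraction) and as a group (the domain of a group homomorphism).\<close>

definition isotropy_groupoid :: "'a groupoid_data \<Rightarrow> 'a \<Rightarrow> 'a groupoid_data" where
  "isotropy_groupoid \<G> x =
    \<lparr>arrows = arrows_between \<G> x x, verts = {x}, src = src \<G>, rng = rng \<G>, gcomp = gcomp \<G>\<rparr>"

definition isotropy_group :: "'a groupoid_data \<Rightarrow> 'a \<Rightarrow> 'a monoid" where
  "isotropy_group \<G> x = \<lparr>carrier = arrows_between \<G> x x, mult = gcomp \<G>, one = x\<rparr>"

definition cocycle :: "'a groupoid_data \<Rightarrow> ('g, 'm) monoid_scheme \<Rightarrow> ('a \<Rightarrow> 'g) \<Rightarrow> bool" where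
  "cocycle \<G> G \<psi> \<longleftrightarrow>
    \<psi> \<in> arrows \<G> \<rightarrow> carrier G \<and> (\<forall>x\<in>verts \<G>. \<psi> x = \<one>\<^bsub>G\<^esub>) \<and>
    (\<forall>a\<in>arrows \<G>. \<forall>b\<in>arrows \<G>. src \<G> a = rng \<G> b \<longrightarrow>
      \<psi> (gcomp \<G> a b) = \<psi> a \<otimes>\<^bsub>G\<^esub> \<psi> b)"

definition nondegenerate :: "'a groupoid_data \<Rightarrow> ('g, 'm) monoid_scheme \<Rightarrow> ('a \<Rightarrow> 'g) \<Rightarrow> bool" where
  "nondegenerate \<G> G \<psi> \<longleftrightarrow> generate G (\<psi> ` arrows \<G>) = carrier G"

definition cocycle_kernel :: "'a groupoid_data \<Rightarrow> ('g, 'm) monoid_scheme \<Rightarrow> ('a \<Rightarrow> 'g) \<Rightarrow> 'a set" where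
  "cocycle_kernel \<G> G \<psi> = {a \<in> arrows \<G>. \<psi> a = \<one>\<^bsub>G\<^esub>}"

definition skew_product ::
  "'a groupoid_data \<Rightarrow> ('g, 'm) monoid_scheme \<Rightarrow> ('a \<Rightarrow> 'g) \<Rightarrow> ('a \<times> 'g) groupoid_data" where
  "skew_product \<G> G \<psi> =
    \<lparr>arrows = arrows \<G> \<times> carrier G,
     verts = verts \<G> \<times> carrier G,
     src = (\<lambda>(a, g). (src \<G> a, g)),
     rng = (\<lambda>(a, g). (rng \<G> a, \<psi> a \<otimes>\<^bsub>G\<^esub> g)),
     gcomp = (\<lambda>(a, g) (b, h). (gcomp \<G> a b, h))\<rparr>"

text \<open>The family is indexed by vertices; values of \<open>t\<close> off \<open>verts \<G>\<close> are irrelevant.\<close>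

definition maximal_tree :: "'a groupoid_data \<Rightarrow> 'a \<Rightarrow> ('a \<Rightarrow> 'a) \<Rightarrow> bool" where
  "maximal_tree \<G> x t \<longleftrightarrow>
    x \<in> verts \<G> \<and> (\<forall>y\<in>verts \<G>. t y \<in> arrows_between \<G> y x) \<and> t x = x"

definition factors_through_retraction ::
  "'a groupoid_data \<Rightarrow> ('g, 'm) monoid_scheme \<Rightarrow> ('a \<Rightarrow> 'g) \<Rightarrow> 'a \<Rightarrow> bool" where
  "factors_through_retraction \<G> G \<psi> x \<longleftrightarrow>
    (\<exists>\<eta> \<phi>. retraction_on \<G> (isotropy_groupoid \<G> x) \<eta> \<and>
      \<phi> \<in> hom (isotropy_group \<G> x) G \<and> (\<forall>a\<in>arrows \<G>. \<psi> a = \<phi> (\<eta> a)))"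

lemma (in groupoid) subgroupoid_isotropy:
  assumes x: "x \<in> verts \<G>"
  shows "subgroupoid (isotropy_groupoid \<G> x) \<G>"
proof -
  have xa: "x \<in> arrows \<G>" using x verts_arrows by blast
  have "groupoid (isotropy_groupoid \<G> x)"
  proof
    fix a assume "a \<in> arrows (isotropy_groupoid \<G> x)"
    then have a: "a \<in> arrows \<G>" "rng \<G> a = x" "src \<G> a = x"
      by (auto simp: isotropy_groupoid_def arrows_between_def)
    then show "\<exists>b\<in>arrows (isotropy_groupoid \<G> x).
        src (isotropy_groupoid \<G> x) b = rng (isotropy_groupoid \<G> x) a \<and>
        rng (isotropy_groupoid \<G> x) b = src (isotropy_groupoid \<G> x) a \<and>
        gcomp (isotropy_groupoid \<G> x) b a = src (isotropy_groupoid \<G> x) a \<and>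
        gcomp (isotropy_groupoid \<G> x) a b = rng (isotropy_groupoid \<G> x) a"
      using inverse_ex[of a] by (auto simp: isotropy_groupoid_def arrows_between_def)
  next
    fix a assume "a \<in> arrows (isotropy_groupoid \<G> x)"
    then show "gcomp (isotropy_groupoid \<G> x) a (src (isotropy_groupoid \<G> x) a) = a"
      using comp_src[of a] by (auto simp: isotropy_groupoid_def arrows_between_def)
  qed (use x xa src_vert rng_vert comp_closed src_comp rng_comp comp_assoc rng_gcomp in
      \<open>auto simp: isotropy_groupoid_def arrows_between_def\<close>)
  then show ?thesis
    using x by (auto simp: subgroupoid_def isotropy_groupoid_def arrows_between_def)
qed

lemma (in groupoid) group_isotropy:
  assumes x: "x \<in> verts \<G>"
  shows "group (isotropy_group \<G> x)"
proof (rule groupI)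
  have xa: "x \<in> arrows \<G>" using x verts_arrows by blast
  then show "\<one>\<^bsub>isotropy_group \<G> x\<^esub> \<in> carrier (isotropy_group \<G> x)"
    using x src_vert rng_vert by (auto simp: isotropy_group_def arrows_between_def)
  fix a assume "a \<in> carrier (isotropy_group \<G> x)"
  then have a: "a \<in> arrows \<G>" "rng \<G> a = x" "src \<G> a = x"
    by (auto simp: isotropy_group_def arrows_between_def)
  show "\<one>\<^bsub>isotropy_group \<G> x\<^esub> \<otimes>\<^bsub>isotropy_group \<G> x\<^esub> a = a"
    using rng_gcomp a by (auto simp: isotropy_group_def)
  show "\<exists>b\<in>carrier (isotropy_group \<G> x).
      b \<otimes>\<^bsub>isotropy_group \<G> x\<^esub> a = \<one>\<^bsub>isotropy_group \<G> x\<^esub>"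
    using inverse_ex[of a] a by (auto simp: isotropy_group_def arrows_between_def)
qed (use comp_closed src_comp rng_comp comp_assoc in
    \<open>auto simp: isotropy_group_def arrows_between_def\<close>)

lemma (in groupoid) groupoid_skew_product:
  assumes "group G" and \<psi>: "cocycle \<G> G \<psi>"
  shows "groupoid (skew_product \<G> G \<psi>)"
proof -
  interpret G: group G by fact
  have \<psi>_in: "\<psi> a \<in> carrier G" if "a \<in> arrows \<G>" for a
    using \<psi> that by (auto simp: cocycle_def)
  have \<psi>_vert: "\<psi> x = \<one>\<^bsub>G\<^esub>" if "x \<in> verts \<G>" for x
    using \<psi> that by (auto simp: cocycle_def)
  have \<psi>_comp: "\<psi> (gcomp \<G> a b) = \<psi> a \<otimes>\<^bsub>G\<^esub> \<psi> b"
    if "a \<in> arrows \<G>" "b \<in> arrows \<G>" "src \<G> a = rng \<G> b" for a b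
    using \<psi> that by (auto simp: cocycle_def)
  show ?thesis
  proof
    fix p assume p: "p \<in> arrows (skew_product \<G> G \<psi>)"
    obtain a g where ag: "p = (a, g)" by force
    with p have a: "a \<in> arrows \<G>" and g: "g \<in> carrier G" by (auto simp: skew_product_def)
    obtain b where b: "b \<in> arrows \<G>" "src \<G> b = rng \<G> a" "rng \<G> b = src \<G> a"
        "gcomp \<G> b a = src \<G> a" "gcomp \<G> a b = rng \<G> a"
      using inverse_ex[OF a] by auto
    have "\<psi> b \<otimes>\<^bsub>G\<^esub> \<psi> a = \<one>\<^bsub>G\<^esub>"
      using \<psi>_comp[OF b(1) a b(2)] b(4) \<psi>_vert[OF src_verts[OF a]] by simp
    then have "\<psi> b \<otimes>\<^bsub>G\<^esub> (\<psi> a \<otimes>\<^bsub>G\<^esub> g) = g"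
      using a b(1) g \<psi>_in by (simp flip: G.m_assoc)
    then show "\<exists>q\<in>arrows (skew_product \<G> G \<psi>).
        src (skew_product \<G> G \<psi>) q = rng (skew_product \<G> G \<psi>) p \<and>
        rng (skew_product \<G> G \<psi>) q = src (skew_product \<G> G \<psi>) p \<and>
        gcomp (skew_product \<G> G \<psi>) q p = src (skew_product \<G> G \<psi>) p \<and>
        gcomp (skew_product \<G> G \<psi>) p q = rng (skew_product \<G> G \<psi>) p"
      using a b g ag \<psi>_in
      by (intro bexI[of _ "(b, \<psi> a \<otimes>\<^bsub>G\<^esub> g)"]) (auto simp: skew_product_def)
  qed (use nonempty verts_arrows src_verts rng_verts src_vert rng_vert comp_closed src_comp rng_comp
        comp_assoc comp_src rng_gcomp \<psi>_in \<psi>_vert \<psi>_comp G.one_closed in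
      \<open>auto simp: skew_product_def G.m_assoc\<close>)
qed

end

theory Submission
  imports Defs
begin

text \<open>
  All seven conditions are measured against one statement about a single, arbitrary vertex
  \<open>x\<close>: the isotropy group at \<open>x\<close> already exhausts \<open>G\<close> under \<open>\<psi>\<close>. Since the skew product has
  an arrow from \<open>(x, g)\<close> to \<open>(y, h)\<close> precisely when some \<open>a \<in> y\<G>x\<close> has \<open>\<psi> a = h g\<inverse>\<close>, the
  skew product is connected iff \<open>\<psi>\<close> maps every hom-set \<open>y\<G>x\<close> onto \<open>G\<close>
  (\<open>connected_skew_product_iff\<close>). In a connected groupoid any hom-set arises from \<open>\<G>\<^sub>x\<close> by
  composing with fixed arrows on both sides, which in \<open>G\<close> becomes multiplication by fixed elements;
  so surjectivity on one isotropy group spreads to all hom-sets.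

  The remaining conditions are tied to surjectivity at \<open>x\<close> by a cycle. If \<open>\<psi>\<close> maps \<open>\<G>\<^sub>x\<close> onto
  \<open>G\<close>, any arrow \<open>x \<rightarrow> y\<close> can be precomposed with an isotropy element that cancels its value, and
  this produces a tree rooted at \<open>x\<close> inside the kernel. A tree \<open>t\<close> gives the retraction
  \<open>a \<mapsto> t\<^sub>z\<inverse> a t\<^sub>y\<close> for \<open>a \<in> z\<G>y\<close>, and \<open>\<psi>\<close> cannot see the difference between \<open>a\<close> and its image when
  \<open>t\<close> lies in the kernel. Finally, a factorization through \<open>\<G>\<^sub>x\<close> forces \<open>\<psi> ` \<G> = \<psi> ` \<G>\<^sub>x\<close>, which
  is a subgroup; here nondegeneracy makes it all of \<open>G\<close>.

  Connectedness of the skew product does not mention \<open>x\<close>. Hence each of the pointed conditions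
  holds at one vertex iff it holds at all of them, and this is how the existential and the universal
  versions come to agree.
\<close>

section \<open>Calculus of hom-sets\<close>

context groupoid
begin

lemma arrows_betweenD:
  assumes "a \<in> arrows_between \<G> y x"
  shows "a \<in> arrows \<G>" "rng \<G> a = y" "src \<G> a = x"
  using assms by (auto simp: arrows_between_def)

lemma arrows_between_self: "a \<in> arrows \<G> \<Longrightarrow> a \<in> arrows_between \<G> (rng \<G> a) (src \<G> a)"
  by (simp add: arrows_between_def)

lemma vert_in_isotropy: "x \<in> verts \<G> \<Longrightarrow> x \<in> arrows_between \<G> x x"
  using verts_arrows src_vert rng_vert by (auto simp: arrows_between_def)

lemma comp_between:
  assumes "a \<in> arrows_between \<G> z y" "b \<in> arrows_between \<G> y x"
  shows "gcomp \<G> a b \<in> arrows_between \<G> z x"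
  using assms comp_closed src_comp rng_comp by (auto simp: arrows_between_def)

lemma comp_assoc_between:
  assumes "a \<in> arrows_between \<G> z y" "b \<in> arrows_between \<G> y x" "c \<in> arrows_between \<G> x w"
  shows "gcomp \<G> (gcomp \<G> a b) c = gcomp \<G> a (gcomp \<G> b c)"
  using assms comp_assoc by (auto simp: arrows_between_def)

lemma comp_vert_right: "a \<in> arrows_between \<G> y x \<Longrightarrow> gcomp \<G> a x = a"
  using comp_src by (auto simp: arrows_between_def)

lemma comp_vert_left: "a \<in> arrows_between \<G> y x \<Longrightarrow> gcomp \<G> y a = a"
  using rng_gcomp by (auto simp: arrows_between_def)

lemma inverse_between:
  assumes "a \<in> arrows_between \<G> y x"
  shows "\<exists>b\<in>arrows_between \<G> x y. gcomp \<G> b a = x \<and> gcomp \<G> a b = y"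
  using assms inverse_ex[of a] by (auto simp: arrows_between_def)

lemma verts_nonempty: "verts \<G> \<noteq> {}"
  using nonempty src_verts by blast

text \<open>Sliding an arrow along a maximal tree to the root. The telescoping product
  \<open>(u\<^sub>z a t\<^sub>y) (u\<^sub>y b t\<^sub>w) = u\<^sub>z a b t\<^sub>w\<close> is what makes this multiplicative, and the normalization
  \<open>t\<^sub>x = x\<close> (hence \<open>u\<^sub>x = x\<close>) is what makes it the identity on \<open>\<G>\<^sub>x\<close>.\<close>

lemma tree_retraction:
  assumes t: "maximal_tree \<G> x t"
    and u: "\<And>y. y \<in> verts \<G> \<Longrightarrow>
      u y \<in> arrows_between \<G> x y \<and> gcomp \<G> (u y) (t y) = x \<and> gcomp \<G> (t y) (u y) = y"
  shows "retraction_on \<G> (isotropy_groupoid \<G> x)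
    (\<lambda>a. gcomp \<G> (gcomp \<G> (u (rng \<G> a)) a) (t (src \<G> a)))"
    (is "retraction_on \<G> _ ?\<eta>")
proof -
  have x: "x \<in> verts \<G>" and tx: "t x = x"
    and t_in: "\<And>y. y \<in> verts \<G> \<Longrightarrow> t y \<in> arrows_between \<G> y x"
    using t by (auto simp: maximal_tree_def)
  have u_in: "\<And>y. y \<in> verts \<G> \<Longrightarrow> u y \<in> arrows_between \<G> x y"
    and ut: "\<And>y. y \<in> verts \<G> \<Longrightarrow> gcomp \<G> (u y) (t y) = x"
    and tu: "\<And>y. y \<in> verts \<G> \<Longrightarrow> gcomp \<G> (t y) (u y) = y"
    using u by auto
  have ux: "u x = x"
    using ut[OF x] tx comp_vert_right[OF u_in[OF x]] by simp
  have \<eta>_in: "?\<eta> a \<in> arrows_between \<G> x x" if a: "a \<in> arrows \<G>" for a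
    using comp_between[OF comp_between[OF u_in[OF rng_verts[OF a]] arrows_between_self[OF a]]
        t_in[OF src_verts[OF a]]] .
  have \<eta>_vert: "?\<eta> y = x" if y: "y \<in> verts \<G>" for y
    using y src_vert rng_vert comp_vert_right[OF u_in[OF y]] ut by simp
  have \<eta>_id: "?\<eta> a = a" if a: "a \<in> arrows_between \<G> x x" for a
    using arrows_betweenD[OF a] comp_vert_left[OF a] comp_vert_right[OF a] tx ux by simp
  have \<eta>_comp: "?\<eta> (gcomp \<G> a b) = gcomp \<G> (?\<eta> a) (?\<eta> b)"
    if a: "a \<in> arrows \<G>" and b: "b \<in> arrows \<G>" and ab: "src \<G> a = rng \<G> b" for a b
  proof -
    define z y w where "z = rng \<G> a" and "y = src \<G> a" and "w = src \<G> b"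
    have v: "z \<in> verts \<G>" "y \<in> verts \<G>" "w \<in> verts \<G>"
      using a b src_verts rng_verts by (auto simp: z_def y_def w_def)
    have a': "a \<in> arrows_between \<G> z y" and b': "b \<in> arrows_between \<G> y w"
      using a b ab by (auto simp: arrows_between_def z_def y_def w_def)
    let ?p = "gcomp \<G> (u z) a" and ?q = "gcomp \<G> b (t w)"
    have p: "?p \<in> arrows_between \<G> x y" and q: "?q \<in> arrows_between \<G> y x"
      using comp_between u_in t_in v a' b' by blast+
    have "gcomp \<G> (?\<eta> a) (?\<eta> b) = gcomp \<G> (gcomp \<G> ?p (t y)) (gcomp \<G> (u y) ?q)"
      using comp_assoc_between[OF u_in[OF v(2)] b' t_in[OF v(3)]] ab
      by (simp add: z_def y_def w_def)
    also have "\<dots> = gcomp \<G> ?p (gcomp \<G> (t y) (gcomp \<G> (u y) ?q))"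
      using comp_assoc_between[OF p t_in[OF v(2)] comp_between[OF u_in[OF v(2)] q]] .
    also have "gcomp \<G> (t y) (gcomp \<G> (u y) ?q) = gcomp \<G> (gcomp \<G> (t y) (u y)) ?q"
      using comp_assoc_between[OF t_in[OF v(2)] u_in[OF v(2)] q] by simp
    also have "\<dots> = ?q"
      using tu[OF v(2)] comp_vert_left[OF q] by simp
    also have "gcomp \<G> ?p ?q = gcomp \<G> (gcomp \<G> ?p b) (t w)"
      using comp_assoc_between[OF p b' t_in[OF v(3)]] by simp
    also have "gcomp \<G> ?p b = gcomp \<G> (u z) (gcomp \<G> a b)"
      using comp_assoc_between[OF u_in[OF v(1)] a' b'] .
    also have "gcomp \<G> (gcomp \<G> (u z) (gcomp \<G> a b)) (t w) = ?\<eta> (gcomp \<G> a b)"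
      using src_comp[OF a b ab] rng_comp[OF a b ab] by (simp add: z_def w_def)
    finally show ?thesis by simp
  qed
  have "groupoid_hom \<G> (isotropy_groupoid \<G> x) ?\<eta>"
    unfolding groupoid_hom_def
  proof (intro conjI ballI impI)
    show "?\<eta> \<in> arrows \<G> \<rightarrow> arrows (isotropy_groupoid \<G> x)"
      using \<eta>_in by (auto simp: isotropy_groupoid_def)
    show "?\<eta> \<in> verts \<G> \<rightarrow> verts (isotropy_groupoid \<G> x)"
      using \<eta>_vert by (auto simp: isotropy_groupoid_def)
  next
    fix a assume a: "a \<in> arrows \<G>"
    show "src (isotropy_groupoid \<G> x) (?\<eta> a) = ?\<eta> (src \<G> a)"
      using arrows_betweenD(3)[OF \<eta>_in[OF a]] \<eta>_vert[OF src_verts[OF a]]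
      by (simp add: isotropy_groupoid_def)
    show "rng (isotropy_groupoid \<G> x) (?\<eta> a) = ?\<eta> (rng \<G> a)"
      using arrows_betweenD(2)[OF \<eta>_in[OF a]] \<eta>_vert[OF rng_verts[OF a]]
      by (simp add: isotropy_groupoid_def)
  next
    fix a b assume "a \<in> arrows \<G>" "b \<in> arrows \<G>" "src \<G> a = rng \<G> b"
    then show "?\<eta> (gcomp \<G> a b) = gcomp (isotropy_groupoid \<G> x) (?\<eta> a) (?\<eta> b)"
      using \<eta>_comp by (simp add: isotropy_groupoid_def)
  qed
  then show ?thesis
    using subgroupoid_isotropy[OF x] \<eta>_id by (simp add: retraction_on_def isotropy_groupoid_def)
qed

end

section \<open>Cocycles on a groupoid\<close>

locale groupoid_cocycle = groupoid \<G> + G: group G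
  for \<G> :: "'a groupoid_data" and G :: "('g, 'm) monoid_scheme" (structure) +
  fixes \<psi> :: "'a \<Rightarrow> 'g"
  assumes cocycle: "cocycle \<G> G \<psi>"
begin

lemma cocycle_closed: "a \<in> arrows_between \<G> y x \<Longrightarrow> \<psi> a \<in> carrier G"
  using cocycle by (auto simp: cocycle_def arrows_between_def)

lemma cocycle_vert: "x \<in> verts \<G> \<Longrightarrow> \<psi> x = \<one>"
  using cocycle by (auto simp: cocycle_def)

lemma cocycle_comp:
  assumes "a \<in> arrows_between \<G> z y" "b \<in> arrows_between \<G> y x"
  shows "\<psi> (gcomp \<G> a b) = \<psi> a \<otimes> \<psi> b"
  using assms cocycle by (auto simp: cocycle_def arrows_between_def)

lemma cocycle_image_subset: "\<psi> ` arrows_between \<G> y x \<subseteq> carrier G"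
  by (auto intro: cocycle_closed)

lemma cocycle_hom_isotropy: "\<psi> \<in> hom (isotropy_group \<G> x) G"
  by (auto simp: hom_def isotropy_group_def cocycle_closed cocycle_comp)

lemma skew_product_arrow_iff:
  assumes g: "g \<in> carrier G" and h: "h \<in> carrier G"
  shows "arrows_between (skew_product \<G> G \<psi>) (y, h) (x, g) \<noteq> {}
    \<longleftrightarrow> h \<otimes> inv g \<in> \<psi> ` arrows_between \<G> y x"
proof -
  have "arrows_between (skew_product \<G> G \<psi>) (y, h) (x, g)
      = {(a, g) |a. a \<in> arrows_between \<G> y x \<and> \<psi> a \<otimes> g = h}"
    using g by (auto simp: arrows_between_def skew_product_def)
  moreover have "\<psi> a \<otimes> g = h \<longleftrightarrow> h \<otimes> inv g = \<psi> a" if "a \<in> arrows_between \<G> y x" for a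
    using G.inv_solve_right'[OF cocycle_closed[OF that] h g] by auto
  ultimately show ?thesis
    by auto
qed

lemma connected_skew_product_iff:
  "connected_groupoid (skew_product \<G> G \<psi>)
    \<longleftrightarrow> (\<forall>x\<in>verts \<G>. \<forall>y\<in>verts \<G>. \<psi> ` arrows_between \<G> y x = carrier G)"
proof -
  have verts: "verts (skew_product \<G> G \<psi>) = verts \<G> \<times> carrier G"
    by (simp add: skew_product_def)
  have "connected_groupoid (skew_product \<G> G \<psi>)
      \<longleftrightarrow> (\<forall>x\<in>verts \<G>. \<forall>g\<in>carrier G. \<forall>y\<in>verts \<G>. \<forall>h\<in>carrier G.
            h \<otimes> inv g \<in> \<psi> ` arrows_between \<G> y x)"
    using groupoid_skew_product[OF G.is_group cocycle]
    by (simp add: connected_groupoid_def verts skew_product_arrow_iff cong: ball_cong)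
  also have "\<dots> \<longleftrightarrow> (\<forall>x\<in>verts \<G>. \<forall>y\<in>verts \<G>. carrier G \<subseteq> \<psi> ` arrows_between \<G> y x)"
    (is "?L \<longleftrightarrow> ?R")
  proof
    assume L: ?L
    show ?R
    proof (intro ballI subsetI)
      fix x y k assume "x \<in> verts \<G>" "y \<in> verts \<G>" "k \<in> carrier G"
      then have "k \<otimes> inv \<one> \<in> \<psi> ` arrows_between \<G> y x"
        using L by blast
      then show "k \<in> \<psi> ` arrows_between \<G> y x"
        using \<open>k \<in> carrier G\<close> by simp
    qed
  next
    assume ?R
    then show ?L
      by (meson G.inv_closed G.m_closed subsetD)
  qed
  also have "\<dots> \<longleftrightarrow> (\<forall>x\<in>verts \<G>. \<forall>y\<in>verts \<G>. \<psi> ` arrows_between \<G> y x = carrier G)"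
    using cocycle_image_subset by blast
  finally show ?thesis .
qed

text \<open>Letting \<open>h\<close> vary over \<open>\<G>\<^sub>x\<close>, the composites \<open>b h a\<close> realize every value \<open>\<psi> b \<cdot> k \<cdot> \<psi> a\<close> with
  \<open>k \<in> G\<close>, and multiplication by \<open>\<psi> b\<close> on the left and by \<open>\<psi> a\<close> on the right permutes \<open>G\<close>.\<close>

lemma isotropy_onto_imp_hom_sets_onto:
  assumes x: "\<psi> ` arrows_between \<G> x x = carrier G"
    and a: "a \<in> arrows_between \<G> x y" and b: "b \<in> arrows_between \<G> z x"
  shows "\<psi> ` arrows_between \<G> z y = carrier G"
proof (intro subset_antisym cocycle_image_subset subsetI)
  fix g assume g: "g \<in> carrier G"
  note \<psi>a = cocycle_closed[OF a] and \<psi>b = cocycle_closed[OF b]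
  have "inv (\<psi> b) \<otimes> g \<otimes> inv (\<psi> a) \<in> carrier G"
    using g \<psi>a \<psi>b by simp
  then obtain h where h: "h \<in> arrows_between \<G> x x"
    and \<psi>h: "\<psi> h = inv (\<psi> b) \<otimes> g \<otimes> inv (\<psi> a)"
    unfolding x[symmetric] by force
  have bh: "gcomp \<G> b h \<in> arrows_between \<G> z x"
    using comp_between[OF b h] .
  have "\<psi> (gcomp \<G> (gcomp \<G> b h) a) = \<psi> b \<otimes> (inv (\<psi> b) \<otimes> g \<otimes> inv (\<psi> a)) \<otimes> \<psi> a"
    using cocycle_comp[OF bh a] cocycle_comp[OF b h] \<psi>h by simp
  also have "\<dots> = (\<psi> b \<otimes> inv (\<psi> b)) \<otimes> g \<otimes> (inv (\<psi> a) \<otimes> \<psi> a)"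
    using g \<psi>a \<psi>b by (simp only: G.m_assoc G.m_closed G.inv_closed)
  also have "\<dots> = g"
    using g \<psi>a \<psi>b by simp
  finally show "g \<in> \<psi> ` arrows_between \<G> z y"
    using comp_between[OF bh a] by force
qed

text \<open>By \<open>isotropy_onto_imp_hom_sets_onto\<close> with \<open>a = x\<close>, every hom-set \<open>y\<G>x\<close> contains an arrow of
  value \<open>\<one>\<close>; a choice of such arrows is the tree.\<close>

lemma kernel_tree_if_isotropy_onto:
  assumes conn: "connected_groupoid \<G>" and x: "x \<in> verts \<G>"
    and onto: "\<psi> ` arrows_between \<G> x x = carrier G"
  shows "\<exists>t. maximal_tree \<G> x t \<and> t ` verts \<G> \<subseteq> cocycle_kernel \<G> G \<psi>"
proof -
  have "\<exists>a\<in>arrows_between \<G> y x. \<psi> a = \<one>" if y: "y \<in> verts \<G>" for y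
  proof -
    obtain b where b: "b \<in> arrows_between \<G> y x"
      using conn x y by (auto simp: connected_groupoid_def)
    have "\<psi> ` arrows_between \<G> y x = carrier G"
      using isotropy_onto_imp_hom_sets_onto[OF onto vert_in_isotropy[OF x] b] .
    then show ?thesis
      using G.one_closed by (metis imageE)
  qed
  then obtain s where s: "\<And>y. y \<in> verts \<G> \<Longrightarrow> s y \<in> arrows_between \<G> y x \<and> \<psi> (s y) = \<one>"
    by metis
  \<comment> \<open>the chosen isotropy element \<open>s x\<close> need not be the identity, so the root is reset to \<open>x\<close>\<close>
  have "maximal_tree \<G> x (s(x := x))" "(s(x := x)) ` verts \<G> \<subseteq> cocycle_kernel \<G> G \<psi>"
    using s x vert_in_isotropy[OF x] cocycle_vert[OF x]
    by (auto simp: maximal_tree_def cocycle_kernel_def arrows_between_def)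
  then show ?thesis by blast
qed

text \<open>The homomorphism through which \<open>\<psi>\<close> factors is \<open>\<psi>\<close> itself on \<open>\<G>\<^sub>x\<close>: the retraction changes an
  arrow only by tree arrows and their inverses, whose values are all \<open>\<one>\<close>.\<close>

lemma factors_if_kernel_tree:
  assumes t: "maximal_tree \<G> x t" and ker: "t ` verts \<G> \<subseteq> cocycle_kernel \<G> G \<psi>"
  shows "factors_through_retraction \<G> G \<psi> x"
proof -
  have t_in: "\<And>y. y \<in> verts \<G> \<Longrightarrow> t y \<in> arrows_between \<G> y x"
    using t by (auto simp: maximal_tree_def)
  have \<psi>t: "\<And>y. y \<in> verts \<G> \<Longrightarrow> \<psi> (t y) = \<one>"
    using ker by (auto simp: cocycle_kernel_def)
  have "\<forall>y\<in>verts \<G>. \<exists>b. b \<in> arrows_between \<G> x y \<and> gcomp \<G> b (t y) = x \<and> gcomp \<G> (t y) b = y"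
    using inverse_between[OF t_in] by blast
  then obtain u where u: "\<And>y. y \<in> verts \<G> \<Longrightarrow>
      u y \<in> arrows_between \<G> x y \<and> gcomp \<G> (u y) (t y) = x \<and> gcomp \<G> (t y) (u y) = y"
    by metis
  have \<psi>u: "\<psi> (u y) = \<one>" if y: "y \<in> verts \<G>" for y
  proof -
    have uy: "u y \<in> arrows_between \<G> x y"
      using u[OF y] by blast
    have "\<psi> (u y) \<otimes> \<psi> (t y) = \<psi> x"
      using cocycle_comp[OF uy t_in[OF y]] u[OF y] by simp
    then show ?thesis
      using \<psi>t[OF y] cocycle_closed[OF uy] t cocycle_vert by (simp add: maximal_tree_def)
  qed
  define \<eta> where "\<eta> = (\<lambda>a. gcomp \<G> (gcomp \<G> (u (rng \<G> a)) a) (t (src \<G> a)))"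
  have "\<psi> a = \<psi> (\<eta> a)" if a: "a \<in> arrows \<G>" for a
  proof -
    note r = rng_verts[OF a] and s = src_verts[OF a] and a' = arrows_between_self[OF a]
    have ur: "u (rng \<G> a) \<in> arrows_between \<G> x (rng \<G> a)"
      using u[OF r] by blast
    show ?thesis
      using cocycle_comp[OF comp_between[OF ur a'] t_in[OF s]] cocycle_comp[OF ur a']
        \<psi>u[OF r] \<psi>t[OF s] cocycle_closed[OF a'] by (simp add: \<eta>_def)
  qed
  moreover have "retraction_on \<G> (isotropy_groupoid \<G> x) \<eta>"
    unfolding \<eta>_def using tree_retraction[OF t u] .
  ultimately show ?thesis
    using cocycle_hom_isotropy unfolding factors_through_retraction_def by blast
qed

text \<open>The image of the homomorphism \<open>\<phi>\<close> is a subgroup containing \<open>\<psi> ` \<G>\<close>, which generates \<open>G\<close>. As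
  a retraction fixes \<open>\<G>\<^sub>x\<close>, the homomorphism \<open>\<phi>\<close> is nothing but \<open>\<psi>\<close> restricted to \<open>\<G>\<^sub>x\<close>.\<close>

lemma isotropy_onto_if_factors:
  assumes nd: "nondegenerate \<G> G \<psi>" and x: "x \<in> verts \<G>"
    and fac: "factors_through_retraction \<G> G \<psi> x"
  shows "\<psi> ` arrows_between \<G> x x = carrier G"
proof -
  obtain \<eta> \<phi> where ret: "retraction_on \<G> (isotropy_groupoid \<G> x) \<eta>"
    and \<phi>: "\<phi> \<in> hom (isotropy_group \<G> x) G"
    and \<psi>\<phi>: "\<And>a. a \<in> arrows \<G> \<Longrightarrow> \<psi> a = \<phi> (\<eta> a)"
    using fac by (auto simp: factors_through_retraction_def)
  have \<eta>_in: "\<eta> a \<in> arrows_between \<G> x x" if "a \<in> arrows \<G>" for a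
    using ret that by (auto simp: retraction_on_def groupoid_hom_def isotropy_groupoid_def)
  have \<eta>_id: "\<eta> a = a" if "a \<in> arrows_between \<G> x x" for a
    using ret that by (simp add: retraction_on_def isotropy_groupoid_def)
  have img: "\<phi> ` arrows_between \<G> x x = \<psi> ` arrows_between \<G> x x"
    using \<psi>\<phi> \<eta>_id arrows_betweenD(1) by (intro image_cong) auto
  interpret \<phi>: group_hom "isotropy_group \<G> x" G \<phi>
    using group_isotropy[OF x] \<phi> G.is_group by (simp add: group_hom_def group_hom_axioms_def)
  have "subgroup (\<phi> ` arrows_between \<G> x x) G"
    using \<phi>.img_is_subgroup by (simp add: isotropy_group_def)
  moreover have "\<psi> ` arrows \<G> \<subseteq> \<phi> ` arrows_between \<G> x x"
    using \<psi>\<phi> \<eta>_in by auto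
  ultimately have "generate G (\<psi> ` arrows \<G>) \<subseteq> \<phi> ` arrows_between \<G> x x"
    using G.generate_subgroup_incl by blast
  then show ?thesis
    using nd img cocycle_image_subset unfolding nondegenerate_def by blast
qed

lemma connected_skew_product_iff_isotropy_onto:
  assumes conn: "connected_groupoid \<G>" and x: "x \<in> verts \<G>"
  shows "connected_groupoid (skew_product \<G> G \<psi>) \<longleftrightarrow> \<psi> ` arrows_between \<G> x x = carrier G"
proof
  assume "connected_groupoid (skew_product \<G> G \<psi>)"
  then show "\<psi> ` arrows_between \<G> x x = carrier G"
    using x by (simp add: connected_skew_product_iff)
next
  assume onto: "\<psi> ` arrows_between \<G> x x = carrier G"
  show "connected_groupoid (skew_product \<G> G \<psi>)"
    unfolding connected_skew_product_iff
  proof (intro ballI)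
    fix y z assume "y \<in> verts \<G>" "z \<in> verts \<G>"
    then obtain a b where "a \<in> arrows_between \<G> x y" "b \<in> arrows_between \<G> z x"
      using conn x unfolding connected_groupoid_def by blast
    then show "\<psi> ` arrows_between \<G> z y = carrier G"
      using isotropy_onto_imp_hom_sets_onto[OF onto] by blast
  qed
qed

lemma isotropy_onto_iff_kernel_tree:
  assumes "connected_groupoid \<G>" "nondegenerate \<G> G \<psi>" "x \<in> verts \<G>"
  shows "\<psi> ` arrows_between \<G> x x = carrier G
    \<longleftrightarrow> (\<exists>t. maximal_tree \<G> x t \<and> t ` verts \<G> \<subseteq> cocycle_kernel \<G> G \<psi>)"
  using kernel_tree_if_isotropy_onto[OF assms(1,3)] factors_if_kernel_tree
    isotropy_onto_if_factors[OF assms(2,3)] by metis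

lemma isotropy_onto_iff_factors:
  assumes "connected_groupoid \<G>" "nondegenerate \<G> G \<psi>" "x \<in> verts \<G>"
  shows "\<psi> ` arrows_between \<G> x x = carrier G \<longleftrightarrow> factors_through_retraction \<G> G \<psi> x"
  using kernel_tree_if_isotropy_onto[OF assms(1,3)] factors_if_kernel_tree
    isotropy_onto_if_factors[OF assms(2,3)] by metis

end

section \<open>The equivalence\<close>

theorem theorem7p24:
  fixes \<G> :: "'a groupoid_data"
    and G :: "('g, 'm) monoid_scheme"
    and \<psi> :: "'a \<Rightarrow> 'g"
  assumes "connected_groupoid \<G>"
    and "group G"
    and "cocycle \<G> G \<psi>"
    and "nondegenerate \<G> G \<psi>"
  shows
    "let i = connected_groupoid (skew_product \<G> G \<psi>);
         ii = (\<forall>x\<in>verts \<G>. \<psi> ` carrier (isotropy_group \<G> x) = carrier G);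
         iii = (\<exists>x\<in>verts \<G>. \<psi> ` carrier (isotropy_group \<G> x) = carrier G);
         iv = (\<exists>x\<in>verts \<G>. \<exists>t. maximal_tree \<G> x t \<and> t ` verts \<G> \<subseteq> cocycle_kernel \<G> G \<psi>);
         v = (\<forall>x\<in>verts \<G>. \<exists>t. maximal_tree \<G> x t \<and> t ` verts \<G> \<subseteq> cocycle_kernel \<G> G \<psi>);
         vi = (\<forall>x\<in>verts \<G>. factors_through_retraction \<G> G \<psi> x);
         vii = (\<exists>x\<in>verts \<G>. factors_through_retraction \<G> G \<psi> x)
     in (i \<longleftrightarrow> ii) \<and> (i \<longleftrightarrow> iii) \<and> (i \<longleftrightarrow> iv) \<and> (i \<longleftrightarrow> v) \<and> (i \<longleftrightarrow> vi) \<and> (i \<longleftrightarrow> vii)"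
proof -
  interpret groupoid_cocycle \<G> G \<psi>
    using assms(1-3)
    by (simp add: groupoid_cocycle_def groupoid_cocycle_axioms_def connected_groupoid_def)
  let ?i = "connected_groupoid (skew_product \<G> G \<psi>)"
  have onto: "\<psi> ` carrier (isotropy_group \<G> x) = carrier G \<longleftrightarrow> ?i" if "x \<in> verts \<G>" for x
    using connected_skew_product_iff_isotropy_onto[OF assms(1) that]
    by (simp add: isotropy_group_def)
  have tree: "(\<exists>t. maximal_tree \<G> x t \<and> t ` verts \<G> \<subseteq> cocycle_kernel \<G> G \<psi>) \<longleftrightarrow> ?i"
    if "x \<in> verts \<G>" for x
    using connected_skew_product_iff_isotropy_onto[OF assms(1) that]
      isotropy_onto_iff_kernel_tree[OF assms(1,4) that] by blast
  have factors: "factors_through_retraction \<G> G \<psi> x \<longleftrightarrow> ?i" if "x \<in> verts \<G>" for x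
    using connected_skew_product_iff_isotropy_onto[OF assms(1) that]
      isotropy_onto_iff_factors[OF assms(1,4) that] by blast
  show ?thesis
    unfolding Let_def using verts_nonempty[folded ex_in_conv]
    by (simp add: onto tree factors cong: ball_cong bex_cong)
qed

end
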